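(* Let $k$ and $q$ be positive integers and $n=q(k+1)$. Let $$C=\mathrm{circ}\big(k,\underbrace{-1,\ldots,-1}_{k},\ldots,k,\underbrace{-1,\ldots,-1}_{k}\big)$$ be the circulant matrix of order $n$ whose generating vector consists of $q$ consecutive copies of the block $(k,-1,\ldots,-1)$ of length $k+1$. The following assertions hold: (i) $C^{2}=nC$ and $C^{\dagger}=\frac{1}{n^{2}}C$. (ii) If $\alpha,\beta\in\mathbb{C}\setminus\{0\}$, then $$\mathrm{circ}\big(\alpha+k\beta,\underbrace{\alpha-\beta,\ldots,\alpha-\beta}_{k},\ldots,\alpha+k\beta,\underbrace{\alpha-\beta,\ldots,\alpha-\beta}_{k}\big)^{\dagger}=\frac{1}{\alpha n^{2}}ee^{t}+\frac{1}{\beta n^{2}}C,$$ where the generating vector consists of $q$ consecutive copies of the block $(\alpha+k\beta,\alpha-\beta,\ldots,\alpha-\beta)$ of length $k+1$.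
   Context: For $c\in\mathbb{C}^n$, $\mathrm{circ}(c)$ is the $n\times n$ circulant matrix whose first row is $(c(1),\ldots,c(n))$ (the generating vector) and each of whose subsequent rows is the cyclic right shift by one of the previous row. $e$ is the column vector in $\mathbb{C}^n$ with all components equal to $1$; $t$ denotes transpose. $A^{\dagger}$ is the Moore--Penrose inverse: the unique matrix $X$ with $AXA=A$, $XAX=X$, $(AX)^{*}=AX$, $(XA)^{*}=XA$. *)

theory Defs
  imports "Jordan_Normal_Form.Schur_Decomposition"
begin

definition cyclic_shift :: "complex vec \<Rightarrow> complex vec" where
  "cyclic_shift c =
     vec (dim_vec c) (\<lambda>j. if j = 0 then c $ (dim_vec c - 1) else c $ (j - 1))"

definition circ :: "complex vec \<Rightarrow> complex mat" where
  "circ c = mat_of_rows (dim_vec c) (map (\<lambda>i. (cyclic_shift ^^ i) c) [0..<dim_vec c])"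

text \<open>\<open>q\<close> consecutive copies of the block \<open>(a, b, \<dots>, b)\<close> of length \<open>k + 1\<close>.\<close>

definition block_vec :: "nat \<Rightarrow> nat \<Rightarrow> complex \<Rightarrow> complex \<Rightarrow> complex vec" where
  "block_vec q k a b = vec_of_list (concat (replicate q (a # replicate k b)))"

definition ones_col :: "nat \<Rightarrow> complex mat" where
  "ones_col n = mat n 1 (\<lambda>_. 1)"

text \<open>The carrier condition is what makes the dimensions match: matrix products in this library
  are total, also for incompatible sizes.\<close>

definition is_mp_inverse :: "complex mat \<Rightarrow> complex mat \<Rightarrow> bool" where
  "is_mp_inverse A X \<longleftrightarrow>
     X \<in> carrier_mat (dim_col A) (dim_row A) \<and>
     A * X * A = A \<and>
     X * A * X = X \<and>
     mat_adjoint (A * X) = A * X \<and>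
     mat_adjoint (X * A) = X * A"

definition mp_inverse :: "complex mat \<Rightarrow> complex mat" where
  "mp_inverse A = (THE X. is_mp_inverse A X)"

lemma mat_adjoint_carrier:
  "A \<in> carrier_mat n m \<Longrightarrow> mat_adjoint A \<in> carrier_mat m n"
  by (auto simp: mat_adjoint_def mat_of_rows_def)

lemma mat_adjoint_index:
  assumes "A \<in> carrier_mat n m" "i < m" "j < n"
  shows "mat_adjoint A $$ (i, j) = conjugate (A $$ (j, i))"
  using assms by (auto simp: mat_adjoint_def mat_of_rows_def)

lemma mat_adjoint_mult:
  fixes A B :: "complex mat"
  assumes A: "A \<in> carrier_mat n m" and B: "B \<in> carrier_mat m p"
  shows "mat_adjoint (A * B) = mat_adjoint B * mat_adjoint A"
proof (rule eq_matI)
  have AB: "A * B \<in> carrier_mat n p" using A B by auto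
  note cs = mat_adjoint_carrier[OF A] mat_adjoint_carrier[OF B] mat_adjoint_carrier[OF AB]
  show "dim_row (mat_adjoint (A * B)) = dim_row (mat_adjoint B * mat_adjoint A)"
    "dim_col (mat_adjoint (A * B)) = dim_col (mat_adjoint B * mat_adjoint A)"
    using cs by auto
  fix i j
  assume "i < dim_row (mat_adjoint B * mat_adjoint A)" "j < dim_col (mat_adjoint B * mat_adjoint A)"
  then have ij: "i < p" "j < n" using cs by auto
  have "mat_adjoint (A * B) $$ (i, j) = cnj ((A * B) $$ (j, i))"
    using mat_adjoint_index[OF AB ij] by simp
  also have "\<dots> = (\<Sum>l<m. cnj (A $$ (j, l)) * cnj (B $$ (l, i)))"
    using A B ij by (simp add: scalar_prod_def atLeast0LessThan)
  also have "\<dots> = (\<Sum>l<m. mat_adjoint B $$ (i, l) * mat_adjoint A $$ (l, j))"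
    using ij by (intro sum.cong) (auto simp: mat_adjoint_index[OF A] mat_adjoint_index[OF B])
  also have "\<dots> = (mat_adjoint B * mat_adjoint A) $$ (i, j)"
    using cs ij by (simp add: scalar_prod_def atLeast0LessThan)
  finally show "mat_adjoint (A * B) $$ (i, j) = (mat_adjoint B * mat_adjoint A) $$ (i, j)" .
qed

lemma is_mp_inverse_unique:
  assumes X: "is_mp_inverse A X" and Y: "is_mp_inverse A Y"
  shows "X = Y"
proof -
  define n m where "n = dim_row A" and "m = dim_col A"
  have c: "A \<in> carrier_mat n m" "X \<in> carrier_mat m n" "Y \<in> carrier_mat m n"
    using X Y by (auto simp: is_mp_inverse_def n_def m_def)
  then have c2: "A * X \<in> carrier_mat n n" "A * Y \<in> carrier_mat n n"
    "X * A \<in> carrier_mat m m" "Y * A \<in> carrier_mat m m"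
    by auto
  note p = X[unfolded is_mp_inverse_def] Y[unfolded is_mp_inverse_def]
  have "A * X = (A * Y) * (A * X)"
    using p c assoc_mult_mat[OF c2(2) c(1) c(2)] by simp
  also have "\<dots> = mat_adjoint ((A * X) * (A * Y))"
    using mat_adjoint_mult[OF c2(1) c2(2)] p by simp
  also have "(A * X) * (A * Y) = A * Y"
    using p c assoc_mult_mat[OF c2(1) c(1) c(3)] by simp
  finally have AX: "A * X = A * Y" using p by simp
  have "X * A = (X * A) * (Y * A)"
    using p assoc_mult_mat[OF c2(3) c(3) c(1)] assoc_mult_mat[OF c(2) c(1) c(3)]
      assoc_mult_mat[OF c(2) c2(2) c(1)] by simp
  also have "\<dots> = mat_adjoint ((Y * A) * (X * A))"
    using mat_adjoint_mult[OF c2(4) c2(3)] p by simp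
  also have "(Y * A) * (X * A) = Y * A"
    using p assoc_mult_mat[OF c2(4) c(2) c(1)] assoc_mult_mat[OF c(3) c(1) c(2)]
      assoc_mult_mat[OF c(3) c2(1) c(1)] by simp
  finally have XA: "X * A = Y * A" using p by simp
  have "X = X * A * X" using p by simp
  also have "\<dots> = Y * (A * X)"
    unfolding XA using assoc_mult_mat[OF c(3) c(1) c(2)] .
  also have "\<dots> = Y * A * Y"
    unfolding AX using assoc_mult_mat[OF c(3) c(1) c(3)] by simp
  finally show ?thesis using p by simp
qed

lemma mp_inverse_eqI: "is_mp_inverse A X \<Longrightarrow> mp_inverse A = X"
  unfolding mp_inverse_def by (rule the_equality) (auto intro: is_mp_inverse_unique)

end

theory Submission
  imports Defs
begin

text \<open>
  Put \<open>m = k + 1\<close>. The circulant generated by the repeated block \<open>(a, b, \<dots>, b)\<close> depends only on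
  whether \<open>i \<equiv> j\<close> modulo \<open>m\<close>, so it is a combination \<open>b J + (a - b) D\<close> of the all-ones matrix \<open>J\<close>
  and the indicator \<open>D\<close> of that congruence. Since \<open>J\<^sup>2 = n J\<close>, \<open>D J = J D = q J\<close> and \<open>D\<^sup>2 = q D\<close>,
  these combinations form a commutative algebra closed under adjoints, and every Penrose
  equation becomes an identity between two pairs of scalars.
\<close>

text \<open>The arguments \<open>x\<close> and \<open>y\<close> are the coordinates with respect to
  J and D, so equations between such matrices follow from equations between pairs of
  scalars.\<close>

definition residue_mat :: "nat \<Rightarrow> nat \<Rightarrow> complex \<Rightarrow> complex \<Rightarrow> complex mat" where
  "residue_mat n m x y = mat n n (\<lambda>(i, j). x + y * of_bool (i mod m = j mod m))"

lemma residue_mat_carrier [simp]: "residue_mat n m x y \<in> carrier_mat n n"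
  by (simp add: residue_mat_def)

lemma dim_residue_mat [simp]:
  "dim_row (residue_mat n m x y) = n" "dim_col (residue_mat n m x y) = n"
  by (simp_all add: residue_mat_def)

lemma smult_residue_mat: "c \<cdot>\<^sub>m residue_mat n m x y = residue_mat n m (c * x) (c * y)"
  by (rule eq_matI) (auto simp: residue_mat_def distrib_left)

lemma add_residue_mat:
  "residue_mat n m x y + residue_mat n m x' y' = residue_mat n m (x + x') (y + y')"
  by (rule eq_matI) (auto simp: residue_mat_def algebra_simps)

lemma mat_adjoint_residue_mat: "mat_adjoint (residue_mat n m x y) = residue_mat n m (cnj x) (cnj y)"
proof (rule eq_matI)
  have "mat_adjoint (residue_mat n m x y) \<in> carrier_mat n n"
    by (simp add: mat_adjoint_carrier)
  then show "dim_row (mat_adjoint (residue_mat n m x y)) = dim_row (residue_mat n m (cnj x) (cnj y))"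
    "dim_col (mat_adjoint (residue_mat n m x y)) = dim_col (residue_mat n m (cnj x) (cnj y))"
    by auto
  fix i j
  assume "i < dim_row (residue_mat n m (cnj x) (cnj y))" "j < dim_col (residue_mat n m (cnj x) (cnj y))"
  then show "mat_adjoint (residue_mat n m x y) $$ (i, j) = residue_mat n m (cnj x) (cnj y) $$ (i, j)"
    by (subst mat_adjoint_index[OF residue_mat_carrier]) (auto simp: residue_mat_def)
qed

text \<open>D enters with coefficient 0, so the modulus \<open>m\<close> is free and can be chosen
  to match the one of \<open>C\<close>.\<close>

lemma ones_col_mult_transpose:
  "ones_col n * transpose_mat (ones_col n) = residue_mat n m 1 0"
  by (rule eq_matI) (auto simp: ones_col_def residue_mat_def scalar_prod_def)

text \<open>The range splits into \<open>q\<close> intervals of length \<open>m\<close>, and on each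
  of them \<open>l mod m\<close> runs once through all residues.\<close>

lemma sum_mod_blocks:
  fixes f :: "nat \<Rightarrow> 'a::semiring_1"
  shows "(\<Sum>l<q * m. f (l mod m)) = of_nat q * (\<Sum>r<m. f r)"
proof -
  have block: "(\<Sum>l=p * m..<p * m + m. f (l mod m)) = (\<Sum>r<m. f r)" for p
    using sum.shift_bounds_nat_ivl[of "\<lambda>l. f (l mod m)" 0 "p * m" m]
    by (simp add: add.commute atLeast0LessThan)
  have "(\<Sum>l<q * m. f (l mod m)) = (\<Sum>p<q. \<Sum>l=p * m..<p * m + m. f (l mod m))"
    by (rule sum.nat_group[symmetric])
  then show ?thesis
    by (simp only: block sum_constant card_lessThan)
qed

lemma mult_residue_mat:
  assumes "n = q * m" "m > 0"
  shows "residue_mat n m x y * residue_mat n m x' y' =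
    residue_mat n m (of_nat n * x * x' + of_nat q * (x * y' + y * x')) (of_nat q * y * y')"
    (is "?L = ?R")
proof (rule eq_matI)
  fix i j
  assume "i < dim_row ?R" "j < dim_col ?R"
  then have ij: "i < n" "j < n" by auto
  define d :: "nat \<Rightarrow> nat \<Rightarrow> complex" where "d i j = of_bool (i mod m = j mod m)" for i j
  \<comment> \<open>Every residue class modulo \<open>m\<close> has exactly \<open>q\<close> members
    below \<open>n\<close>.\<close>
  have row: "(\<Sum>l<n. d i l) = of_nat q" for i
    using sum_mod_blocks[of "\<lambda>r. of_bool (i mod m = r) :: complex" m q] assms
    by (simp add: d_def of_bool_def sum.delta)
  have sym: "d l j = d j l" for l j
    by (auto simp: d_def)
  \<comment> \<open>Transitivity of congruence: the factor \<open>d i j\<close> does not depend on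
    \<open>l\<close>, so summing over \<open>l\<close> leaves a row sum of D.\<close>
  have prod: "d i l * d l j = d i j * d i l" for l
    by (auto simp: d_def)
  have summand: "(x + y * d i l) * (x' + y' * d l j) =
      x * x' + x * y' * d j l + y * x' * d i l + y * y' * d i j * d i l" for l
  proof -
    have "(x + y * d i l) * (x' + y' * d l j) =
        x * x' + x * y' * d l j + y * x' * d i l + y * y' * (d i l * d l j)"
      by (simp add: algebra_simps)
    then show ?thesis
      by (simp only: prod) (simp only: sym[of l j] mult.assoc)
  qed
  have "?L $$ (i, j) = (\<Sum>l<n. (x + y * d i l) * (x' + y' * d l j))"
    using ij by (simp add: residue_mat_def scalar_prod_def atLeast0LessThan d_def)
  also have "\<dots> = (\<Sum>l<n. x * x' + x * y' * d j l + y * x' * d i l + y * y' * d i j * d i l)"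
    by (simp only: summand)
  also have "\<dots> = of_nat n * x * x' + of_nat q * (x * y' + y * x') + of_nat q * y * y' * d i j"
    by (simp add: sum.distrib row flip: sum_distrib_left) (simp add: algebra_simps)
  also have "\<dots> = ?R $$ (i, j)"
    using ij by (simp add: residue_mat_def d_def)
  finally show "?L $$ (i, j) = ?R $$ (i, j)" .
qed auto

lemma dim_funpow_cyclic_shift [simp]: "dim_vec ((cyclic_shift ^^ i) c) = dim_vec c"
  by (induction i) (auto simp: cyclic_shift_def)

text \<open>Each shift reads from the left neighbour, cyclically. Adding \<open>dim_vec c\<close>
  before subtracting \<open>i\<close> keeps the subtraction on naturals from truncating.\<close>

lemma funpow_cyclic_shift_index:
  assumes "i \<le> dim_vec c" "j < dim_vec c"
  shows "(cyclic_shift ^^ i) c $ j = c $ ((j + dim_vec c - i) mod dim_vec c)"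
  using assms
proof (induction i arbitrary: j)
  case (Suc i)
  have "(cyclic_shift ^^ Suc i) c $ j =
      (cyclic_shift ^^ i) c $ (if j = 0 then dim_vec c - 1 else j - 1)"
    using Suc.prems by (simp add: cyclic_shift_def)
  also have "\<dots> = c $ (((if j = 0 then dim_vec c - 1 else j - 1) + dim_vec c - i) mod dim_vec c)"
    using Suc.prems by (subst Suc.IH) auto
  also have "((if j = 0 then dim_vec c - 1 else j - 1) + dim_vec c - i) mod dim_vec c =
      (j + dim_vec c - Suc i) mod dim_vec c"
  proof (cases "j = 0")
    case True
    \<comment> \<open>The wrap-around at \<open>j = 0\<close> yields an index that is too large by
      exactly one period.\<close>
    have "dim_vec c - 1 + dim_vec c - i = (dim_vec c - Suc i) + dim_vec c"
      using Suc.prems by simp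
    then show ?thesis using True by (simp only: mod_add_self2) simp
  qed simp
  finally show ?case .
qed simp

lemma circ_index:
  assumes "i < dim_vec c" "j < dim_vec c"
  shows "circ c $$ (i, j) = c $ ((j + dim_vec c - i) mod dim_vec c)"
  using assms by (simp add: circ_def mat_of_rows_def funpow_cyclic_shift_index)

lemma nth_concat_replicate:
  "j < q * length xs \<Longrightarrow> concat (replicate q xs) ! j = xs ! (j mod length xs)"
proof (induction q arbitrary: j)
  case (Suc q)
  then show ?case
    by (cases "j < length xs") (auto simp: nth_append le_mod_geq)
qed simp

lemma dim_block_vec [simp]: "dim_vec (block_vec q k a b) = q * (k + 1)"
  by (simp add: block_vec_def length_concat sum_list_replicate)

lemma block_vec_index:
  assumes "j < q * (k + 1)"
  shows "block_vec q k a b $ j = (if j mod (k + 1) = 0 then a else b)"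
proof -
  have "j mod (k + 1) < k + 1" by simp
  then have "(a # replicate k b) ! (j mod (k + 1)) = (if j mod (k + 1) = 0 then a else b)"
    by (simp add: nth_Cons' del: mod_less_divisor)
  then show ?thesis
    using assms nth_concat_replicate[of j q "a # replicate k b"]
    by (simp add: block_vec_def vec_of_list_index)
qed

text \<open>As \<open>k + 1\<close> divides the order, reduction modulo the order is invisible
  modulo \<open>k + 1\<close>, and the entry depends only on \<open>j - i\<close> modulo
  \<open>k + 1\<close>.\<close>

lemma circ_block_vec:
  "circ (block_vec q k a b) = residue_mat (q * (k + 1)) (k + 1) b (a - b)"
proof (rule eq_matI)
  let ?m = "k + 1" and ?n = "q * (k + 1)"
  show "dim_row (circ (block_vec q k a b)) = dim_row (residue_mat ?n ?m b (a - b))"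
    "dim_col (circ (block_vec q k a b)) = dim_col (residue_mat ?n ?m b (a - b))"
    by (simp_all add: circ_def)
  fix i j
  assume "i < dim_row (residue_mat ?n ?m b (a - b))" "j < dim_col (residue_mat ?n ?m b (a - b))"
  then have ij: "i < ?n" "j < ?n" by auto
  have "circ (block_vec q k a b) $$ (i, j) = block_vec q k a b $ ((j + ?n - i) mod ?n)"
    using ij by (subst circ_index) auto
  also have "\<dots> = (if (j + ?n - i) mod ?n mod ?m = 0 then a else b)"
    using ij by (intro block_vec_index mod_less_divisor) linarith
  also have "(j + ?n - i) mod ?n mod ?m = (j + ?n - i) mod ?m"
    by (intro mod_mod_cancel dvd_triv_right)
  \<comment> \<open>Because \<open>i < ?n\<close>, the difference is a true one, and its
    divisibility by \<open>?m\<close> is a congruence.\<close>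
  also have "(j + ?n - i) mod ?m = 0 \<longleftrightarrow> (j + ?n) mod ?m = i mod ?m"
    using ij by (subst mod_eq_dvd_iff_nat) (auto simp: dvd_eq_mod_eq_0)
  also have "(j + ?n) mod ?m = j mod ?m"
    by (rule mod_mult_self1)
  finally show "circ (block_vec q k a b) $$ (i, j) = residue_mat ?n ?m b (a - b) $$ (i, j)"
    using ij by (auto simp: residue_mat_def)
qed

theorem proposition4p7:
  fixes k q n :: nat and C :: "complex mat"
  assumes "k > 0" and "q > 0" and "n = q * (k + 1)"
    and "C = circ (block_vec q k (of_nat k) (-1))"
  shows "(C ^\<^sub>m 2 = of_nat n \<cdot>\<^sub>m C \<and> mp_inverse C = (1 / (of_nat n)\<^sup>2) \<cdot>\<^sub>m C) \<and>
    (\<forall>\<alpha> \<beta> :: complex. \<alpha> \<noteq> 0 \<longrightarrow> \<beta> \<noteq> 0 \<longrightarrow>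
       mp_inverse (circ (block_vec q k (\<alpha> + of_nat k * \<beta>) (\<alpha> - \<beta>))) =
         (1 / (\<alpha> * (of_nat n)\<^sup>2)) \<cdot>\<^sub>m (ones_col n * transpose_mat (ones_col n)) +
         (1 / (\<beta> * (of_nat n)\<^sup>2)) \<cdot>\<^sub>m C)"
proof (intro conjI allI impI)
  define m where "m = k + 1"
  have n: "n = q * m" and m: "m > 0"
    using assms(3) by (simp_all add: m_def)
  define Q M :: complex where "Q = of_nat q" and "M = of_nat m"
  have nz: "Q \<noteq> 0" "M \<noteq> 0"
    using \<open>q > 0\<close> m by (simp_all add: Q_def M_def)
  have N: "of_nat n = Q * M"
    unfolding n Q_def M_def by (rule of_nat_mult)
  have real: "cnj Q = Q" "cnj M = M"
    by (simp_all add: Q_def M_def)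
  have mult: "residue_mat n m x y * residue_mat n m x' y' =
      residue_mat n m (Q * (M * x * x' + x * y' + y * x')) (Q * y * y')" for x y x' y'
    unfolding mult_residue_mat[OF n m] N by (simp add: Q_def algebra_simps)
  \<comment> \<open>\<open>u\<close> and \<open>v\<close> are the coordinates of the product of the
    two matrices, which is the same in either order. Their being real gives both adjoint equations;
    \<open>EA\<close> and \<open>EX\<close> give AXA = A and XAX = X.\<close>
  have mp_eq: "mp_inverse (residue_mat n m x y) = residue_mat n m x' y'"
    if E: "u = Q * (M * x * x' + x * y' + y * x')" "v = Q * y * y'"
      and real: "cnj u = u" "cnj v = v"
      and EA: "Q * (M * u * x + u * y + v * x) = x" "Q * v * y = y"
      and EX: "Q * (M * u * x' + u * y' + v * x') = x'" "Q * v * y' = y'"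
    for x y x' y' u v
  proof -
    have AX: "residue_mat n m x y * residue_mat n m x' y' = residue_mat n m u v"
      unfolding mult E ..
    have XA: "residue_mat n m x' y' * residue_mat n m x y = residue_mat n m u v"
      unfolding mult E by (simp add: ac_simps)
    show ?thesis
      by (intro mp_inverse_eqI)
        (simp only: is_mp_inverse_def AX XA mat_adjoint_residue_mat real dim_residue_mat
          residue_mat_carrier, simp only: mult EA EX simp_thms)
  qed
  have C: "C = residue_mat n m (-1) M"
    unfolding assms(3,4) m_def M_def circ_block_vec by (simp add: add.commute)
  show "C ^\<^sub>m 2 = of_nat n \<cdot>\<^sub>m C"
  proof -
    have "C ^\<^sub>m 2 = C * C"
      unfolding C numeral_2_eq_2 pow_mat.simps by simp
    also have "\<dots> = of_nat n \<cdot>\<^sub>m C"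
      unfolding C N mult smult_residue_mat by simp
    finally show ?thesis .
  qed
  show "mp_inverse C = (1 / (of_nat n)\<^sup>2) \<cdot>\<^sub>m C"
    unfolding C N smult_residue_mat
    \<comment> \<open>The product is C^2 / n^2 = C / n, where C = M D - J and n = Q M.\<close>
    by (rule mp_eq[where u = "- 1 / (Q * M)" and v = "1 / Q"])
      (use nz in \<open>simp_all add: real field_simps power2_eq_square\<close>)
  fix \<alpha> \<beta> :: complex
  assume nonzero: "\<alpha> \<noteq> 0" "\<beta> \<noteq> 0"
  \<comment> \<open>Hence the matrix is (\<alpha> - \<beta>) J + M \<beta> D = \<alpha> J + \<beta>
    C.\<close>
  have "(\<alpha> + of_nat k * \<beta>) - (\<alpha> - \<beta>) = M * \<beta>"
    by (simp add: m_def M_def algebra_simps)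
  then have A: "circ (block_vec q k (\<alpha> + of_nat k * \<beta>) (\<alpha> - \<beta>)) = residue_mat n m (\<alpha> - \<beta>) (M * \<beta>)"
    using circ_block_vec[of q k "\<alpha> + of_nat k * \<beta>" "\<alpha> - \<beta>"] by (simp only: assms(3) m_def)
  show "mp_inverse (circ (block_vec q k (\<alpha> + of_nat k * \<beta>) (\<alpha> - \<beta>))) =
         (1 / (\<alpha> * (of_nat n)\<^sup>2)) \<cdot>\<^sub>m (ones_col n * transpose_mat (ones_col n)) +
         (1 / (\<beta> * (of_nat n)\<^sup>2)) \<cdot>\<^sub>m C"
    unfolding C A N ones_col_mult_transpose[of n m] smult_residue_mat add_residue_mat
  \<comment> \<open>Since J C = C J = 0, J^2 = n J and C^2 = n C, the mixed terms vanish and the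
    product is (J + C) / n = M D / n = D / Q.\<close>
  proof (rule mp_eq[where u = 0 and v = "1 / Q"])
    show "0 = Q * (M * (\<alpha> - \<beta>) * (1 / (\<alpha> * (Q * M)\<^sup>2) * 1 + 1 / (\<beta> * (Q * M)\<^sup>2) * - 1) +
        (\<alpha> - \<beta>) * (1 / (\<alpha> * (Q * M)\<^sup>2) * 0 + 1 / (\<beta> * (Q * M)\<^sup>2) * M) +
        M * \<beta> * (1 / (\<alpha> * (Q * M)\<^sup>2) * 1 + 1 / (\<beta> * (Q * M)\<^sup>2) * - 1))"
      using nz nonzero by (simp add: field_simps power2_eq_square)
    show "1 / Q = Q * (M * \<beta>) * (1 / (\<alpha> * (Q * M)\<^sup>2) * 0 + 1 / (\<beta> * (Q * M)\<^sup>2) * M)"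
      using nz nonzero by (simp add: field_simps power2_eq_square)
  qed (use nz in \<open>simp_all add: real\<close>)
qed

end
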